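(* Let $t$ be an odd positive integer. Suppose there exist infinitely many positive integers $n$ such that, for some $c\in\mathbb{F}_{2^n}^*$, the function $x\mapsto cx^t$ is planar on $\mathbb{F}_{2^n}$. Then $t=1$.
   Context: A function $f:\mathbb{F}_{2^n}\to\mathbb{F}_{2^n}$ is called planar if for every $\epsilon\in\mathbb{F}_{2^n}^*$ the map $x\mapsto f(x+\epsilon)+f(x)+\epsilon x$ is a permutation of $\mathbb{F}_{2^n}$. *)

theory Defs
  imports "HOL-Algebra.AbelCoset"
begin

(* Intended for a finite field K of characteristic two, where subtraction is addition.
   Any field with 2^n elements serves as F_{2^n}: it is unique up to isomorphism, and
   planarity is invariant under field isomorphism. *)
definition planar :: "('a, 'm) ring_scheme \<Rightarrow> ('a \<Rightarrow> 'a) \<Rightarrow> bool" where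
  "planar K f \<longleftrightarrow> f \<in> carrier K \<rightarrow> carrier K \<and>
     (\<forall>\<epsilon> \<in> carrier K - {\<zero>\<^bsub>K\<^esub>}.
        bij_betw (\<lambda>x. f (x \<oplus>\<^bsub>K\<^esub> \<epsilon>) \<oplus>\<^bsub>K\<^esub> f x \<oplus>\<^bsub>K\<^esub> \<epsilon> \<otimes>\<^bsub>K\<^esub> x) (carrier K) (carrier K))"

end

theory Submission
  imports Defs "HOL-Algebra.Algebraic_Closure_Type" "HOL-Number_Theory.Residues" "HOL-Library.Z2"
begin

text \<open>
  Suppose $t \ge 3$, put $e = t - 2$ and let $c x^t$ be planar on the field with $q = 2^n$
  elements. Comparing the values of the difference maps at $0$ and at $\epsilon y$ shows that
  $f(z) = c\,((z+1)^t + z^t + 1)\,(z+1)^{2e-1}$ takes no nonzero $e$-th power as a value.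
  With $d = \gcd(e, q-1)$ and $v = (q-1)/d$ this says that $f(a)^v$, if nonzero, lies in the
  set $A$ of the fewer than $d$ nontrivial $d$-th roots of unity.

  Stepanov's method refutes this for large $q$, and since $f$ may be raised to a
  power of two, no multiplicities are needed. Write $q = q'Q$ with a fixed power $Q$ of two,
  $Q = dB + 1$ and $q' = dB' + 1$, and let $g(a^Q) = f(a)^Q$. For
  $W(X) = \sum x_{ljk}\, g(X)^{B'l} X^{q'j + k}$ with $l < d$, $j < J$, $k < B'$ one finds
  $f(a)^{(d-1)B}\, W(a^Q) = C_w(a)$, where $w = f(a)^v \in A$ and
  $C_w(Y) = \sum x_{ljk}\, w^l f(Y)^{(d-1-l)B} Y^{j + Qk}$ has small degree. The conditions
  $C_w = 0$ for $w \in A$ are fewer than the unknowns $x_{ljk}$, so they have a nontrivial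
  solution, and then $W$ has almost $q$ zeros but smaller degree. It is not zero:
  $g$ has a simple zero at $0$, so the terms of $W$ have distinct orders at $0$.
\<close>

hide_const (open) module.smult up_ring.coeff up_ring.monom Polynomial.order

section \<open>Linear systems and orders of vanishing at 0\<close>

text \<open>Gaussian elimination, one equation at a time: if equation \<open>e\<close> involves an
  unknown \<open>j\<close>, solve it for \<open>j\<close> and substitute in the others. This costs
  one equation and one unknown, so the strict inequality of cardinalities survives.\<close>

lemma exists_nontrivial_solution:
  fixes M :: "'e \<Rightarrow> 'i \<Rightarrow> 'a::field"
  assumes "finite E" "finite I" "card E < card I"
  shows "\<exists>x. (\<exists>i\<in>I. x i \<noteq> 0) \<and> (\<forall>e\<in>E. (\<Sum>i\<in>I. M e i * x i) = 0)"
  using assms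
proof (induction E arbitrary: I M rule: finite_induct)
  case empty
  then have "I \<noteq> {}" by auto
  then show ?case by (intro exI[of _ "\<lambda>_. 1"]) auto
next
  case (insert e E)
  show ?case
  proof (cases "\<forall>i\<in>I. M e i = 0")
    case True
    obtain x where x: "\<exists>i\<in>I. x i \<noteq> 0" "\<forall>e\<in>E. (\<Sum>i\<in>I. M e i * x i) = 0"
      using insert.IH[of I M] insert.prems insert.hyps by auto
    then show ?thesis using True by (intro exI[of _ x]) auto
  next
    case False
    then obtain j where j: "j \<in> I" "M e j \<noteq> 0" by auto
    define I' where "I' = I - {j}"
    have I': "finite I'" "card E < card I'" "j \<notin> I'" "I = insert j I'"
      using insert j by (auto simp: I'_def)
    obtain x where x: "\<exists>i\<in>I'. x i \<noteq> 0"
      "\<forall>e'\<in>E. (\<Sum>i\<in>I'. (M e' i - M e' j / M e j * M e i) * x i) = 0"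
      using insert.IH[of I' "\<lambda>e' i. M e' i - M e' j / M e j * M e i"] I' by auto
    define y where "y = x(j := - (\<Sum>i\<in>I'. M e i * x i) / M e j)"
    have split: "(\<Sum>i\<in>I. M e' i * y i)
        = (\<Sum>i\<in>I'. M e' i * x i) - M e' j / M e j * (\<Sum>i\<in>I'. M e i * x i)" for e'
    proof -
      have "(\<Sum>i\<in>I'. M e' i * y i) = (\<Sum>i\<in>I'. M e' i * x i)"
        using I' by (intro sum.cong) (auto simp: y_def)
      then show ?thesis using I' by (simp add: y_def)
    qed
    have "(\<Sum>i\<in>I. M e i * y i) = 0" using j by (simp add: split)
    moreover have "(\<Sum>i\<in>I. M e' i * y i) = 0" if "e' \<in> E" for e'
      using x(2)[rule_format, OF that] unfolding split
      by (simp add: left_diff_distrib sum_subtractf sum_distrib_left mult.assoc)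
    moreover have "\<exists>i\<in>I. y i \<noteq> 0" using x(1) I' by (auto simp: y_def)
    ultimately show ?thesis by (intro exI[of _ y]) auto
  qed
qed

text \<open>Among the terms with nonzero coefficient, the one of least order contributes a lowest
  coefficient that no other term can cancel.\<close>

lemma sum_distinct_order_nonzero:
  fixes H :: "'i \<Rightarrow> 'a::idom poly" and E :: "'i \<Rightarrow> nat"
  assumes I: "finite I" "inj_on E I" and H: "\<And>i. i \<in> I \<Longrightarrow> poly (H i) 0 \<noteq> 0"
    and x: "\<exists>i\<in>I. x i \<noteq> 0"
  shows "(\<Sum>i\<in>I. smult (x i) (monom 1 (E i) * H i)) \<noteq> 0"
proof
  assume eq: "(\<Sum>i\<in>I. smult (x i) (monom 1 (E i) * H i)) = 0"
  obtain j where j: "j \<in> I" "x j \<noteq> 0"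
    and min: "\<And>i. i \<in> I \<Longrightarrow> x i \<noteq> 0 \<Longrightarrow> E j \<le> E i"
    using x ex_has_least_nat[of "\<lambda>i. i \<in> I \<and> x i \<noteq> 0" _ E] by blast
  have "coeff (\<Sum>i\<in>I. smult (x i) (monom 1 (E i) * H i)) (E j)
      = (\<Sum>i\<in>I. if i = j then x j * poly (H j) 0 else 0)"
    unfolding coeff_sum
  proof (rule sum.cong[OF refl])
    fix i assume i: "i \<in> I"
    show "coeff (smult (x i) (monom 1 (E i) * H i)) (E j) = (if i = j then x j * poly (H j) 0 else 0)"
    proof (cases "i = j \<or> x i = 0")
      case True
      then show ?thesis using j by (auto simp: coeff_monom_mult poly_0_coeff_0)
    next
      case False
      then have "E j < E i" using min[of i] i j I(2) by (metis inj_on_contraD le_neq_implies_less)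
      then show ?thesis using False by (simp add: coeff_monom_mult)
    qed
  qed
  also have "\<dots> = x j * poly (H j) 0" using I j by simp
  finally show False using eq j H[of j] by simp
qed

lemma card_poly_roots_le:
  fixes p :: "'a::idom poly"
  assumes "p \<noteq> 0" "Z \<subseteq> {x. poly p x = 0}"
  shows "card Z \<le> degree p"
  using card_mono[OF poly_roots_finite[OF assms(1)] assms(2)] card_poly_roots_bound[OF assms(1)]
  by linarith

section \<open>Stepanov's method\<close>

text \<open>The auxiliary polynomial \<open>W\<close> gets too many zeros: at least
  \<open>q - N\<close>, while its degree is below \<open>q' * (N + J) = q - q'\<close>, which is at
  most \<open>q - N\<close>. The assumption \<open>count\<close> makes the unknowns outnumber the
  linear conditions that force these zeros.\<close>

lemma stepanov_contradiction:
  fixes f g h :: "'a::field poly" and S A :: "'a set" and N d q Q q' B B' v J :: nat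
  assumes S: "card S = q" "finite S" "\<And>a. a \<in> S \<Longrightarrow> a ^ q = a"
    and q: "q = q' * Q" "q = d * v + 1" "Q = d * B + 1" "q' = d * B' + 1"
    and f: "f \<noteq> 0" "degree f \<le> N" and g: "degree g \<le> N" "g = [:0, 1:] * h" "poly h 0 \<noteq> 0"
    and fg: "\<And>a. a \<in> S \<Longrightarrow> poly g (a ^ Q) = poly f a ^ Q"
    and A: "finite A" "card A < d" "\<And>a. a \<in> S \<Longrightarrow> poly f a \<noteq> 0 \<Longrightarrow> poly f a ^ v \<in> A"
    and J: "J + N + 1 = Q" "N \<le> q'"
    and count: "(d - 1) * (J + (d - 1) * B * N + B' * Q) < d * J * B'"
  shows False
proof -
  define I where "I = {..<d} \<times> {..<J} \<times> {..<B'}"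
  \<comment> \<open>Every \<open>P w i\<close> has degree below \<open>D\<close>, so the vanishing
    of the combination for one \<open>w\<close> amounts to \<open>D\<close> linear
    conditions.\<close>
  define D where "D = J + (d - 1) * B * N + B' * Q"
  \<comment> \<open>On \<open>S\<close>, \<open>g (a ^ Q) ^ (B' * l)\<close> is
    \<open>f a ^ (Q * B' * l)\<close>, and \<open>Q * B' = v - B\<close>. Multiplying by
    \<open>f ^ ((d - 1) * B)\<close> keeps the exponent of \<open>f\<close> nonnegative for all
    \<open>l < d\<close> after \<open>w ^ l\<close> is split off.\<close>
  define P where "P = (\<lambda>w (l, j, k). smult (w ^ l) (f ^ ((d - 1 - l) * B) * monom 1 (j + Q * k)))"
  have I: "finite I" "card I = d * J * B'" by (auto simp: I_def)
  have "card (A \<times> {..<D}) \<le> (d - 1) * D"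
    unfolding card_cartesian_product card_lessThan using A(2) by (intro mult_le_mono1) linarith
  then have "card (A \<times> {..<D}) < card I" using count by (simp add: D_def I)
  then obtain x where x: "\<exists>i\<in>I. x i \<noteq> 0"
    "\<forall>e\<in>A \<times> {..<D}. (\<Sum>i\<in>I. coeff (P (fst e) i) (snd e) * x i) = 0"
    using exists_nontrivial_solution[of "A \<times> {..<D}" I "\<lambda>e i. coeff (P (fst e) i) (snd e)"] A I
    by auto
  have degP: "degree (P w i) < D" if "i \<in> I" for w i
  proof -
    obtain l j k where i: "i = (l, j, k)" by (cases i)
    with that have ljk: "l < d" "j < J" "k < B'" by (auto simp: I_def)
    have "degree (P w i) \<le> degree (f ^ ((d - 1 - l) * B)) + (j + Q * k)"
      unfolding P_def i prod.case
      by (intro order.trans[OF degree_smult_le] order.trans[OF degree_mult_le] add_mono degree_monom_le order.refl)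
    also have "degree (f ^ ((d - 1 - l) * B)) \<le> ((d - 1 - l) * B) * N"
      using f(2) by (intro order.trans[OF degree_power_le]) (simp add: mult.commute)
    also have "\<dots> \<le> (d - 1) * B * N" by (intro mult_le_mono) auto
    finally have "degree (P w i) \<le> (d - 1) * B * N + (j + Q * k)" by simp
    moreover have "Q * k \<le> B' * Q" using ljk by simp
    ultimately show ?thesis using ljk(2) unfolding D_def by linarith
  qed
  have P0: "(\<Sum>i\<in>I. smult (x i) (P w i)) = 0" if "w \<in> A" for w
  proof (rule poly_eqI)
    fix n
    show "coeff (\<Sum>i\<in>I. smult (x i) (P w i)) n = coeff 0 n"
    proof (cases "n < D")
      case True
      then show ?thesis using x(2)[rule_format, of "(w, n)"] that
        by (simp add: coeff_sum mult.commute)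
    next
      case False
      then have "coeff (P w i) n = 0" if "i \<in> I" for i
        using degP[OF that] by (intro coeff_eq_0) (metis linorder_not_le order.strict_trans2)
      then show ?thesis by (simp add: coeff_sum)
    qed
  qed
  \<comment> \<open>As \<open>g = X * h\<close>, the term
    \<open>g ^ (B' * l) * X ^ (q' * j + k)\<close> is \<open>X\<close> to the power
    \<open>E i\<close> times \<open>H i\<close>, and \<open>H i\<close> does not vanish at
    0.\<close>
  define E where "E = (\<lambda>(l, j, k). B' * l + q' * j + k)"
  define H :: "nat \<times> nat \<times> nat \<Rightarrow> 'a poly" where "H = (\<lambda>(l, j, k). h ^ (B' * l))"
  define W where "W = (\<Sum>i\<in>I. smult (x i) (monom 1 (E i) * H i))"
  \<comment> \<open>\<open>E\<close> is a mixed radix expansion: \<open>k < B'\<close>, and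
    \<open>B' * l + k < q'\<close> because \<open>q' = d * B' + 1\<close>. So division by
    \<open>q'\<close> recovers \<open>j\<close>, and division by \<open>B'\<close> recovers
    \<open>l\<close>.\<close>
  have "inj_on E I"
  proof (rule inj_onI)
    fix i i' assume *: "i \<in> I" "i' \<in> I" "E i = E i'"
    obtain l j k where i: "i = (l, j, k)" by (cases i)
    obtain l' j' k' where i': "i' = (l', j', k')" by (cases i')
    have k: "k < B'" "k' < B'" and l: "l < d" "l' < d" using * by (auto simp: i i' I_def)
    have small: "B' * l + k < q'" if "k < B'" "l < d" for k l
    proof -
      have "B' * (l + 1) \<le> B' * d" using that by (intro mult_le_mono) auto
      then show ?thesis using that q(4) by (simp add: algebra_simps)
    qed
    have eq: "(B' * l + k) + q' * j = (B' * l' + k') + q' * j'"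
      using * by (simp add: E_def i i' algebra_simps)
    have div: "(r + q' * j) div q' = j" if "r < q'" for r j using that by simp
    have "j = ((B' * l + k) + q' * j) div q'" using div[OF small[of k l]] k l by simp
    also have "\<dots> = j'" unfolding eq using div[OF small[of k' l']] k l by simp
    finally have "j = j'" .
    with eq have eq': "k + B' * l = k' + B' * l'" by simp
    have "l = (k + B' * l) div B'" using k by simp
    also have "\<dots> = l'" unfolding eq' using k by simp
    finally show "i = i'" using eq' \<open>j = j'\<close> by (simp add: i i')
  qed
  then have W: "W \<noteq> 0" unfolding W_def using g(3) x(1) I
    by (intro sum_distinct_order_nonzero) (auto simp: H_def)
  have dq: "q' > 0" "d > 0" using q(4) A(2) by auto
  have hg: "degree g = degree h + 1"
    using g(3) by (cases "h = 0") (simp_all add: g(2) degree_pCons_eq)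
  have "J > 0" using count by (cases J) auto
  have "degree W < q' * (N + J)"
  proof -
    have "degree (smult (x i) (monom 1 (E i) * H i)) \<le> q' * (N + J) - 1" if "i \<in> I" for i
    proof -
      obtain l j k where i: "i = (l, j, k)" by (cases i)
      with that have ljk: "l < d" "j < J" "k < B'" by (auto simp: I_def)
      have "degree (smult (x i) (monom 1 (E i) * H i)) \<le> E i + degree (H i)"
        by (intro order.trans[OF degree_smult_le] order.trans[OF degree_mult_le] add_mono degree_monom_le order.refl)
      also have "\<dots> \<le> E i + B' * l * degree h"
        by (simp add: H_def i) (metis degree_power_le mult.commute)
      also have "\<dots> = B' * l * degree g + q' * j + k" by (simp add: E_def i hg algebra_simps)
      also have "B' * l * degree g \<le> q' * N"
        using q(4) ljk g(1) by (intro mult_le_mono) (auto intro: le_SucI simp: mult.commute)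
      also have "q' * N + q' * j + k < q' * N + q' * (j + 1)"
      proof -
        have "B' \<le> d * B'" using dq by simp
        then have "k < q'" using ljk(3) unfolding q(4) by linarith
        then show ?thesis by simp
      qed
      also have "\<dots> \<le> q' * N + q' * J" using ljk by (intro add_mono mult_le_mono) auto
      finally show ?thesis by (simp add: algebra_simps)
    qed
    then have "degree W \<le> q' * (N + J) - 1" unfolding W_def using I by (intro degree_sum_le) auto
    moreover have "q' * (N + J) > 0" using dq \<open>J > 0\<close> by simp
    ultimately show ?thesis by linarith
  qed
  moreover have "card ((\<lambda>a. a ^ Q) ` {a\<in>S. poly f a \<noteq> 0}) \<le> degree W"
  proof (rule card_poly_roots_le[OF W], clarsimp)
    fix a assume a: "a \<in> S" "poly f a \<noteq> 0"
    define w where "w = poly f a ^ v"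
    have "w \<in> A" using A(3) a by (simp add: w_def)
    \<comment> \<open>Compare \<open>d * v + 1\<close> with
      \<open>(d * B' + 1) * (d * B + 1)\<close>; both equal \<open>q\<close>.\<close>
    have v: "v = B' * Q + B"
    proof -
      have "d * v + 1 = (d * B' + 1) * (d * B + 1)" using q by metis
      then have "d * v = d * (B' * Q + B)" by (simp add: q(3) algebra_simps)
      then show ?thesis using dq by simp
    qed
    \<comment> \<open>At \<open>a ^ Q\<close> the high power \<open>X ^ (q' * j)\<close> becomes
      \<open>a ^ (q * j) = a ^ j\<close>. This collapse is what lets \<open>P\<close> have low
      degree.\<close>
    have "poly f a ^ ((d - 1) * B) * poly (monom 1 (E i) * H i) (a ^ Q) = poly (P w i) a"
      if "i \<in> I" for i
    proof -
      obtain l j k where i: "i = (l, j, k)" by (cases i)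
      with that have ljk: "l < d" "j < J" "k < B'" by (auto simp: I_def)
      have "poly (monom 1 (E i) * H i) (a ^ Q) = (a ^ Q * poly h (a ^ Q)) ^ (B' * l) * (a ^ (q' * Q)) ^ j * a ^ (Q * k)"
        by (simp add: E_def H_def i poly_monom power_add power_mult_distrib algebra_simps flip: power_mult)
      also have "a ^ Q * poly h (a ^ Q) = poly f a ^ Q" using fg[OF a(1)] by (simp add: g(2))
      also have "a ^ (q' * Q) = a" using S(3)[OF a(1)] q(1) by simp
      finally have 1: "poly (monom 1 (E i) * H i) (a ^ Q) = poly f a ^ (Q * B' * l) * a ^ (j + Q * k)"
        by (simp add: power_add mult.assoc flip: power_mult)
      obtain l' where "d - 1 = l + l'" using ljk(1) by (metis le_iff_add Suc_le_eq Suc_le_mono Suc_pred' dq(2))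
      then have "(d - 1) * B + Q * B' * l = v * l + (d - 1 - l) * B"
        by (simp add: v algebra_simps)
      then have "poly f a ^ ((d - 1) * B) * poly (monom 1 (E i) * H i) (a ^ Q)
          = poly f a ^ (v * l + (d - 1 - l) * B) * a ^ (j + Q * k)"
        unfolding 1 by (metis mult.assoc power_add)
      also have "\<dots> = poly (P w i) a"
        by (simp add: P_def i w_def poly_monom power_add power_mult mult.assoc)
      finally show ?thesis .
    qed
    then have "poly f a ^ ((d - 1) * B) * poly W (a ^ Q) = poly (\<Sum>i\<in>I. smult (x i) (P w i)) a"
      unfolding W_def poly_sum sum_distrib_left
      by (intro sum.cong) (auto simp del: poly_mult simp add: mult.left_commute)
    also have "\<dots> = 0" by (simp add: P0[OF \<open>w \<in> A\<close>])
    finally show "poly W (a ^ Q) = 0" using a by simp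
  qed
  moreover have "card ((\<lambda>a. a ^ Q) ` {a\<in>S. poly f a \<noteq> 0}) \<ge> q - N"
  proof -
    \<comment> \<open>Raising to the power \<open>q'\<close> undoes raising to the power
      \<open>Q\<close>, since \<open>a ^ (Q * q') = a\<close> on \<open>S\<close>.\<close>
    have "inj_on (\<lambda>a. a ^ Q) S"
      by (rule inj_on_inverseI[where g = "\<lambda>b. b ^ q'"])
         (use S(3) q(1) in \<open>simp add: mult.commute flip: power_mult\<close>)
    then have "card ((\<lambda>a. a ^ Q) ` {a\<in>S. poly f a \<noteq> 0}) = card {a\<in>S. poly f a \<noteq> 0}"
      by (intro card_image) (auto intro: inj_on_subset)
    moreover have "{a\<in>S. poly f a \<noteq> 0} = S - {a\<in>S. poly f a = 0}" by auto
    moreover have "card (S - {a\<in>S. poly f a = 0}) = q - card {a\<in>S. poly f a = 0}"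
      using S by (subst card_Diff_subset) auto
    moreover have "card {a\<in>S. poly f a = 0} \<le> N"
      by (rule order.trans[OF card_poly_roots_le[OF f(1)] f(2)]) auto
    ultimately show ?thesis by simp
  qed
  moreover have "q' * (N + J) + N \<le> q"
  proof -
    have "q' * (N + J) + q' = q" using J(1) unfolding q(1) by (simp flip: J(1) add: algebra_simps)
    then show ?thesis using J(2) by linarith
  qed
  ultimately show False by linarith
qed

section \<open>Roots of unity, power residues and the choice of the power of two\<close>

lemma power_gcd_eq_1:
  fixes z :: "'a::field"
  assumes "z ^ m = 1" "z ^ n = 1" "m > 0"
  shows "z ^ gcd m n = 1"
proof -
  obtain x y where "m * x = n * y + gcd m n" using bezout_nat[of m n] assms(3) by auto
  then have "z ^ (m * x) = z ^ (n * y) * z ^ gcd m n" by (simp add: power_add)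
  then show ?thesis using assms by (simp add: power_mult)
qed

lemma roots_of_unity:
  fixes k :: nat
  assumes "k > 0"
  shows "finite {z::'a::field. z ^ k = 1}" "card {z::'a::field. z ^ k = 1} \<le> k"
proof -
  define p where "p = monom 1 k - (1 :: 'a poly)"
  have "coeff p k = 1" using assms by (simp add: p_def)
  then have p: "p \<noteq> 0" by auto
  have "degree p \<le> k" unfolding p_def by (intro degree_diff_le) (auto simp: degree_monom_le)
  moreover have roots: "{z. z ^ k = 1} = {z. poly p z = 0}" by (simp add: p_def poly_monom)
  ultimately show "card {z::'a::field. z ^ k = 1} \<le> k"
    using card_poly_roots_le[OF p, of "{z. z ^ k = 1}"] by simp
  show "finite {z::'a::field. z ^ k = 1}" unfolding roots by (rule poly_roots_finite[OF p])
qed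

text \<open>Counting stands in for cyclicity of the unit group. Two nonzero elements with the same
  \<open>e\<close>-th power differ by a \<open>d\<close>-th root of unity, where
  \<open>d = gcd e (q - 1)\<close>, so there are at least \<open>v\<close> nonzero
  \<open>e\<close>-th powers. All of them satisfy \<open>z ^ v = 1\<close>, which has at most
  \<open>v\<close> solutions, so they exhaust these solutions.\<close>

lemma power_residue_criterion:
  fixes S :: "'a::field set"
  assumes S: "S = {x. x ^ q = x}" "card S = q" "q \<ge> 2"
    and e: "e > 0" and v: "q - 1 = gcd e (q - 1) * v"
    and y: "y \<in> S" "y \<noteq> 0" "y ^ v = 1"
  shows "\<exists>w\<in>S. w \<noteq> 0 \<and> w ^ e = y"
proof -
  define d where "d = gcd e (q - 1)"
  have d: "d > 0" using e by (simp add: d_def)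
  have dv: "q - 1 = d * v" unfolding d_def by (rule v)
  have fin: "finite S" using S by (metis card.infinite not_numeral_le_zero)
  have "0 \<in> S" using S by auto
  then have card: "card (S - {0}) = q - 1" using S fin by simp
  have unit: "x ^ (q - 1) = 1" if "x \<in> S - {0}" for x
  proof -
    have "x * x ^ (q - 1) = x * 1" using that S by (simp flip: power_Suc)
    then have "x = 0 \<or> x ^ (q - 1) = 1" by (simp only: mult_cancel_left)
    then show ?thesis using that by auto
  qed
  define H where "H = (\<lambda>x. x ^ e) ` (S - {0})"
  have finH: "finite H" using fin by (simp add: H_def)
  define F where "F = (\<lambda>h. {x \<in> S - {0}. x ^ e = h})"
  have fibre: "card (F h) \<le> d" if h: "h \<in> H" for h
  proof -
    obtain a where a: "a \<in> S - {0}" "h = a ^ e" using h unfolding H_def by blast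
    have "F h \<subseteq> (\<lambda>z. a * z) ` {z. z ^ d = 1}"
    proof
      fix x assume x: "x \<in> F h"
      then have "(x / a) ^ e = 1" "(x / a) ^ (q - 1) = 1"
        using a unit[of x] unit[of a] by (auto simp: F_def power_divide)
      then have "(x / a) ^ d = 1" unfolding d_def using e by (intro power_gcd_eq_1)
      then show "x \<in> (\<lambda>z. a * z) ` {z. z ^ d = 1}"
        using a by (intro image_eqI[of _ _ "x / a"]) auto
    qed
    then have "card (F h) \<le> card ((\<lambda>z. a * z) ` {z. z ^ d = 1})"
      using roots_of_unity(1)[OF d] by (intro card_mono) auto
    also have "\<dots> \<le> card {z::'a. z ^ d = 1}" using roots_of_unity(1)[OF d] by (rule card_image_le)
    also have "\<dots> \<le> d" by (rule roots_of_unity(2)[OF d])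
    finally show ?thesis .
  qed
  have "S - {0} = (\<Union>h\<in>H. F h)" by (auto simp: F_def H_def)
  then have "q - 1 \<le> (\<Sum>h\<in>H. card (F h))"
    using card card_UN_le[OF finH, of F] by metis
  also have "\<dots> \<le> (\<Sum>h\<in>H. d)" by (rule sum_mono[OF fibre])
  finally have "d * v \<le> d * card H" unfolding dv by (simp add: mult.commute)
  then have "v \<le> card H" using d by simp
  have v0: "v > 0" using dv S(3) by (cases v) auto
  have "H \<subseteq> {z. z ^ v = 1}"
  proof
    fix h assume "h \<in> H"
    then obtain a where a: "a \<in> S - {0}" "h = a ^ e" unfolding H_def by blast
    obtain e' where e': "e = d * e'" by (metis d_def gcd_dvd1 dvdE)
    have "a ^ (d * v) = 1" using unit[OF a(1)] unfolding dv .
    moreover have "h ^ v = (a ^ (d * v)) ^ e'"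
      unfolding a(2) e' by (simp add: mult_ac flip: power_mult)
    ultimately show "h \<in> {z. z ^ v = 1}" by simp
  qed
  then have "H = {z. z ^ v = 1}"
    using roots_of_unity[OF v0, where 'a = 'a] \<open>v \<le> card H\<close> by (intro card_seteq) auto
  then have "y \<in> H" using y by simp
  then show ?thesis by (auto simp: H_def)
qed

text \<open>The gcd \<open>d\<close> varies with the field, so \<open>Q\<close> must be congruent to
  1 modulo every candidate at once. A multiple of \<open>fact e\<close> is a multiple of
  \<open>totient d\<close> for each \<open>d\<close> concerned, and Euler's theorem applies; the
  factor \<open>L\<close> makes the power large.\<close>

lemma exists_power_of_two_congruent_1:
  fixes e L :: nat
  shows "\<exists>m. 2 ^ m \<ge> L \<and> (\<forall>d. odd d \<longrightarrow> d \<le> e \<longrightarrow> d dvd 2 ^ m - (1::nat))"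
proof (intro exI[of _ "fact e * L"] conjI allI impI)
  have "L \<le> fact e * L" by simp
  also have "\<dots> \<le> 2 ^ (fact e * L)" by (rule less_imp_le[OF less_exp])
  finally show "L \<le> 2 ^ (fact e * L)" .
  fix d :: nat assume d: "odd d" "d \<le> e"
  then have "d > 0" by (auto intro: Nat.gr0I)
  then have "1 \<le> totient d" "totient d \<le> e" using d totient_le[of d] by (auto simp: Suc_le_eq)
  then have "totient d dvd fact e * L" by (rule dvd_mult2[OF dvd_fact])
  then obtain r where r: "fact e * L = totient d * r" by auto
  have "[2 ^ totient d = 1] (mod d)" using d by (intro euler_theorem) (simp add: coprime_commute)
  then have "[(2 ^ totient d) ^ r = 1 ^ r] (mod d)" by (rule cong_pow)
  then have "[2 ^ (fact e * L) = 1] (mod d)" by (simp add: r power_mult)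
  then show "d dvd 2 ^ (fact e * L) - (1::nat)"
    by (metis cong_to_1_nat)
qed

section \<open>Power functions on the fixed field of a Frobenius power in characteristic two\<close>

context
  fixes S :: "'a::field set" and q n :: nat
  assumes char2: "CHAR('a) = 2" and q: "q = 2 ^ n" and S: "S = {x. x ^ q = x}"
begin

lemma char2_frobenius: "(x + y :: 'a) ^ 2 ^ k = x ^ 2 ^ k + y ^ 2 ^ k"
  using freshmans_dream'[where x = x and y = y and m = "2 ^ k" and n = k] char2 by simp

lemma fixed_field_add: "x \<in> S \<Longrightarrow> y \<in> S \<Longrightarrow> x + y \<in> S"
  by (simp add: S q char2_frobenius)

lemma fixed_field_mult: "x \<in> S \<Longrightarrow> y \<in> S \<Longrightarrow> x * y \<in> S"
  by (simp add: S power_mult_distrib)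

lemma fixed_field_power: "x \<in> S \<Longrightarrow> x ^ k \<in> S"
  by (simp add: S flip: power_mult) (metis mult.commute power_mult)

lemma fixed_field_divide: "x \<in> S \<Longrightarrow> y \<in> S \<Longrightarrow> x / y \<in> S"
  by (simp add: S power_divide)

lemma fixed_field_1: "1 \<in> S"
  by (simp add: S)

lemma char2_add_self: "x + x = (0::'a)"
proof -
  have "(2::'a) = 0" using of_nat_CHAR[where 'a = 'a] char2 by simp
  then show ?thesis by (metis mult_2 mult_zero_left)
qed

text \<open>The assumption \<open>planar\<close> is what injectivity of the difference map in
  direction \<open>u\<close> says about the points 0 and \<open>u * y\<close>. The bounds on
  \<open>m\<close> and \<open>n\<close> are those that the count in Stepanov's method
  requires.\<close>

lemma monomial_not_planar_over_large_field:
  assumes t: "odd t" "t \<ge> 3" and card: "card S = q"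
    and c: "c \<in> S" "c \<noteq> 0"
    and planar: "\<And>u y. u \<in> S \<Longrightarrow> u \<noteq> 0 \<Longrightarrow> y \<in> S \<Longrightarrow> y \<noteq> 0 \<Longrightarrow>
      c * u ^ t * ((y + 1) ^ t + y ^ t + 1) \<noteq> u ^ 2 * y"
    and m: "2 ^ m \<ge> (t - 2) * (3 * t + 1) + 1"
      "\<And>d. odd d \<Longrightarrow> d \<le> t - 2 \<Longrightarrow> d dvd 2 ^ m - (1::nat)"
    and n: "n \<ge> m + (t - 2) * (t - 2) * 2 ^ m * (3 * t + 1) + 1"
  shows False
proof -
  \<comment> \<open>\<open>e\<close> is the exponent left when \<open>u ^ 2\<close> is cancelled
    against \<open>u ^ t\<close>. \<open>N\<close> bounds the degree \<open>t + (2 * e - 1)\<close>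
    of the product \<open>p * r\<close> below.\<close>
  define e N Q q' where "e = t - 2" and "N = 3 * t" and "Q = (2::nat) ^ m" and "q' = (2::nat) ^ (n - m)"
  define d where "d = gcd e (q - 1)"
  have e: "e > 0" "t = e + 2" using t by (auto simp: e_def)
  have d: "d > 0" "d \<le> e" "d dvd q - 1" "d dvd e"
    using e by (auto simp: d_def intro: gcd_le1_nat)
  have "odd d" using t e d(4) by (metis even_add even_numeral dvd_trans)
  then have "d dvd Q - 1" using m(2) d by (simp add: Q_def e_def)
  then obtain B where B: "Q = d * B + 1" using m(1) by (auto simp: Q_def elim!: dvdE) (metis Suc_pred add.commute plus_1_eq_Suc zero_less_numeral zero_less_power)
  have qq: "q = q' * Q" using n by (simp add: q q'_def Q_def flip: power_add)
  have q1: "q \<ge> 1" "q' \<ge> 1" by (auto simp: q q'_def)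
  obtain v where v: "q - 1 = d * v" using d(3) by auto
  then have v': "q = d * v + 1" using q1 by simp
  have "d dvd q' - 1"
  proof -
    have "q - 1 = q' * (d * B) + (q' - 1)" using q1 by (simp add: qq B algebra_simps)
    then have "d dvd q' * (d * B) + (q' - 1)" using d(3) by simp
    moreover have "d dvd q' * (d * B)" by simp
    ultimately show ?thesis using dvd_add_right_iff by blast
  qed
  then obtain B' where B': "q' = d * B' + 1" using q1 by (metis Suc_pred' add.commute dvdE plus_1_eq_Suc Suc_eq_plus1 less_eq_Suc_le One_nat_def)
  have big: "q' > e * e * Q * (N + 1) + 1"
  proof -
    have "e * e * Q * (N + 1) + 1 \<le> n - m" using n by (simp add: e_def Q_def N_def)
    also have "\<dots> < q'" unfolding q'_def by (rule less_exp)
    finally show ?thesis .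
  qed
  define J where "J = Q - N - 1"
  have "d * (N + 1) \<le> e * (N + 1)" using d by (intro mult_le_mono) auto
  then have QN: "d * (N + 1) + 1 \<le> Q" using m(1) by (simp add: Q_def e_def N_def)
  have "N + 1 \<le> d * (N + 1)" using mult_le_mono1[of 1 d "N + 1"] d(1) by simp
  then have J: "J + N + 1 = Q" using QN by (simp add: J_def)
  have "1 \<le> e * e * Q" using e by (simp add: Q_def Suc_le_eq)
  then have "N + 1 \<le> e * e * Q * (N + 1)" using mult_le_mono1[of 1 "e * e * Q" "N + 1"] by simp
  then have "N \<le> q'" using big by simp
  \<comment> \<open>The bound on \<open>Q\<close> gives \<open>(d - 1) * Q + 1 \<le> d * J\<close>,
    a surplus of \<open>B'\<close> after multiplication by \<open>B'\<close>. The remaining terms do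
    not involve \<open>B'\<close> and are smaller than it, because \<open>q'\<close> is
    large.\<close>
  have count: "(d - 1) * (J + (d - 1) * B * N + B' * Q) < d * J * B'"
  proof -
    have "e * (e * Q * (N + 1)) < d * B'" using big B' by (simp add: algebra_simps)
    also have "\<dots> \<le> e * B'" using d by simp
    finally have B'big: "e * Q * (N + 1) < B'" by simp
    have dB: "(d - 1) * B \<le> Q" using B by (simp add: diff_mult_distrib)
    have "(d - 1) * (J + (d - 1) * B * N) \<le> e * (Q + Q * N)"
      using d J dB by (intro mult_le_mono add_mono) auto
    then have 1: "(d - 1) * (J + (d - 1) * B * N) < B'" using B'big by (simp add: algebra_simps)
    have "(d - 1) * Q + 1 \<le> d * J"
    proof -
      have "d * Q = d * J + d * (N + 1)" using J by (metis add.assoc distrib_left)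
      moreover have "(d - 1) * Q + Q = d * Q" using d(1) by (simp add: diff_mult_distrib)
      ultimately show ?thesis using QN by linarith
    qed
    then have "((d - 1) * Q + 1) * B' \<le> d * J * B'" by (rule mult_le_mono1)
    then show ?thesis using 1 by (simp add: algebra_simps)
  qed
  define p where "p = monom 1 t + [:1, 1:] ^ t + (1 :: 'a poly)"
  have py: "poly p y = (y + 1) ^ t + y ^ t + 1" for y
    by (simp add: p_def poly_monom add_ac)
  have "poly p 0 = 0" using e by (simp add: py char2_add_self)
  then obtain p1 where p1: "p = [:0, 1:] * p1" by (auto simp: poly_eq_0_iff_dvd)
  have t1: "(of_nat t :: 'a) = 1"
  proof -
    obtain k where k: "t = 2 * k + 1" using t(1) by (elim oddE)
    have "(of_nat t :: 'a) = (of_nat k + of_nat k) + 1"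
      unfolding k by (simp only: mult_2 of_nat_add of_nat_1)
    then show ?thesis by (simp only: char2_add_self add_0_left)
  qed
  \<comment> \<open>The linear coefficient of \<open>p\<close> is \<open>t\<close>, which is 1 in
    characteristic two because \<open>t\<close> is odd. So 0 is a simple zero of \<open>p\<close>,
    and hence of \<open>g\<close>.\<close>
  have "coeff p 1 = 1"
    using t t1 by (simp add: p_def coeff_linear_poly_power)
  moreover have "coeff p 1 = coeff p1 0" unfolding p1 by (simp add: coeff_pCons)
  ultimately have p10: "poly p1 0 = 1" by (simp add: poly_0_coeff_0)
  define r where "r = [:1, 1 :: 'a:] ^ (2 * e - 1)"
  define f where "f = smult c (p * r)"
  \<comment> \<open>The coefficients of \<open>p\<close> and \<open>r\<close> lie in the prime
    field, so raising to the power \<open>Q\<close> changes only the factor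
    \<open>c\<close>.\<close>
  define g where "g = smult (c ^ Q) (p * r)"
  define h where "h = smult (c ^ Q) (p1 * r)"
  have "poly h 0 \<noteq> 0" using c p10 by (simp add: h_def r_def)
  have gh: "g = [:0, 1:] * h" by (simp add: g_def h_def p1)
  have "p \<noteq> 0" using \<open>coeff p 1 = 1\<close> by auto
  then have "f \<noteq> 0" using c by (simp add: f_def r_def)
  have "degree p \<le> t" unfolding p_def
    by (intro degree_add_le degree_monom_le) (auto simp: degree_linear_power)
  then have "degree (p * r) \<le> N"
    using e by (intro order.trans[OF degree_mult_le]) (simp add: r_def degree_linear_power N_def)
  then have "degree f \<le> N" "degree g \<le> N" by (auto simp: f_def g_def)
  have fg: "poly g (a ^ Q) = poly f a ^ Q" if "a \<in> S" for a
  proof -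
    have frob: "(x + y) ^ Q = x ^ Q + y ^ Q" for x y :: 'a
      by (simp add: Q_def char2_frobenius)
    have comm: "(x ^ k) ^ Q = (x ^ Q) ^ k" for x :: 'a and k
      by (simp add: mult.commute flip: power_mult)
    have "poly p (a ^ Q) = poly p a ^ Q" "poly r (a ^ Q) = poly r a ^ Q"
      by (simp_all add: py r_def frob comm)
    then show ?thesis by (simp add: f_def g_def power_mult_distrib)
  qed
  have fval: "poly f a = c * ((a + 1) ^ t + a ^ t + 1) * (a + 1) ^ (2 * e - 1)" for a
    by (simp add: f_def py r_def add.commute)
  define A where "A = {z::'a. z ^ d = 1} - {1}"
  have "finite A" "card A < d"
    using roots_of_unity[OF d(1), where 'a = 'a] d(1) by (auto simp: A_def)
  have A: "poly f a ^ v \<in> A" if a: "a \<in> S" "poly f a \<noteq> 0" for a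
  proof -
    have fS: "poly f a \<in> S" unfolding fval using a c
      by (intro fixed_field_mult fixed_field_add fixed_field_power fixed_field_1)
    then have "poly f a * poly f a ^ (q - 1) = poly f a * 1"
      using q1 by (simp add: S flip: power_Suc)
    then have "poly f a = 0 \<or> poly f a ^ (q - 1) = 1" by (simp only: mult_cancel_left)
    then have "poly f a ^ (q - 1) = 1" using a by auto
    then have 1: "(poly f a ^ v) ^ d = 1"
      unfolding v by (simp add: mult.commute flip: power_mult)
    \<comment> \<open>Otherwise \<open>f a\<close> would be a nonzero \<open>e\<close>-th power
      \<open>w ^ e\<close>, and \<open>w\<close> yields a pair \<open>u\<close>, \<open>y\<close>
      that violates \<open>planar\<close>.\<close>
    have "poly f a ^ v \<noteq> 1"
    proof
      assume "poly f a ^ v = 1"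
      moreover have "q \<ge> 2" using n unfolding q by (metis self_le_power add_gr_0 le_eq_less_or_eq less_le_trans one_le_numeral power_increasing power_one_right zero_less_one trans_le_add2)
      ultimately obtain w where w: "w \<in> S" "w \<noteq> 0" "w ^ e = poly f a"
        using power_residue_criterion[OF S card, of e v "poly f a"] v e fS a by (auto simp: d_def)
      define y where "y = a + 1"
      have ay: "y + 1 = a" by (simp add: y_def add.assoc char2_add_self)
      \<comment> \<open>\<open>y\<close> is nonzero because \<open>f a\<close> contains it to the
        positive power \<open>2 * e - 1\<close>.\<close>
      have y: "y \<in> S" "y \<noteq> 0"
        using a fixed_field_add[OF a(1) fixed_field_1] e by (auto simp: y_def fval)
      \<comment> \<open>Chosen so that \<open>u ^ e = y ^ (2 * e) / f a\<close>; together with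
        \<open>c * ((y + 1) ^ t + y ^ t + 1) * y ^ (2 * e) = f a * y\<close> this produces the
        forbidden equality.\<close>
      define u where "u = y ^ 2 / w"
      have u: "u \<in> S" "u \<noteq> 0" using y w by (auto simp: u_def intro: fixed_field_divide fixed_field_power)
      have "c * u ^ t * ((y + 1) ^ t + y ^ t + 1) = u ^ 2 * (c * ((y + 1) ^ t + y ^ t + 1) * y ^ (2 * e) / w ^ e)"
      proof -
        have ue: "u ^ e = y ^ (2 * e) / w ^ e" by (simp add: u_def power_divide power_mult)
        have ut: "u ^ t = u ^ 2 * u ^ e" unfolding e(2) power_add by (rule mult.commute)
        show ?thesis unfolding ut ue by (simp add: mult_ac)
      qed
      also have "c * ((y + 1) ^ t + y ^ t + 1) * y ^ (2 * e) = poly f a * y"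
      proof -
        have "y ^ (2 * e) = y ^ (2 * e - 1) * y" using e by (cases e) auto
        then show ?thesis using ay by (simp add: fval flip: y_def)
      qed
      finally have "c * u ^ t * ((y + 1) ^ t + y ^ t + 1) = u ^ 2 * y" using w a by simp
      then show False using planar[OF u y] by simp
    qed
    then show ?thesis using 1 by (simp add: A_def)
  qed
  have "finite S" using card q1 by (intro card_ge_0_finite) simp
  have pow_q: "a ^ q = a" if "a \<in> S" for a using that S by simp
  show False
    by (rule stepanov_contradiction[of S q q' Q d v B B' f N g h A J];
        fact card \<open>finite S\<close> pow_q qq v' B B' \<open>f \<noteq> 0\<close> \<open>degree f \<le> N\<close> \<open>degree g \<le> N\<close> gh
          \<open>poly h 0 \<noteq> 0\<close> fg \<open>finite A\<close> \<open>card A < d\<close> A J \<open>N \<le> q'\<close> count)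
qed

end

section \<open>Embedding a finite field of even order in an algebraic closure\<close>

text \<open>The \<open>2 ^ n\<close>-fold sum of the unit is \<open>\<one> \<oplus> \<one>\<close>
  to the power \<open>n\<close>. It vanishes by Lagrange's theorem in the additive group, and a
  domain has no nilpotents.\<close>

lemma (in domain) order_power_of_2_imp_char_2:
  assumes "order R = 2 ^ n"
  shows "\<one> \<oplus> \<one> = \<zero>"
proof -
  have pow: "add_pow R (2 ^ k :: nat) \<one> = (\<one> \<oplus> \<one>) [^] k" for k :: nat
  proof (induction k)
    case (Suc k)
    have "add_pow R (2 ^ Suc k :: nat) \<one> = add_pow R (2 ^ k :: nat) \<one> \<oplus> add_pow R (2 ^ k :: nat) \<one>"
      by (simp add: mult_2 add.nat_pow_mult[symmetric])
    also have "\<dots> = (\<one> \<oplus> \<one>) [^] k \<otimes> (\<one> \<oplus> \<one>)"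
      by (simp add: Suc r_distr)
    finally show ?case by simp
  qed simp
  have "add_pow R (2 ^ n :: nat) \<one> = \<zero>"
    using add.pow_order_eq_1[of \<one>] assms by (simp add: Coset.order_def)
  then have "(\<one> \<oplus> \<one>) [^] n = \<zero>" by (simp add: pow)
  then show ?thesis
    by (induction n) (auto simp: integral_iff)
qed

text \<open>
  A generator of the unit group makes the field a quotient of the polynomial ring over the prime
  field; a root of the generator of the kernel in the algebraic closure gives the embedding.
\<close>
lemma finite_field_char2_embedding:
  fixes K :: "('a, 'm) ring_scheme" (structure)
  assumes "field K" "order K = 2 ^ n" "n > 0"
  shows "\<exists>\<phi> :: 'a \<Rightarrow> bit alg_closure. inj_on \<phi> (carrier K) \<and> \<phi> \<one> = 1 \<and>
    (\<forall>x\<in>carrier K. \<forall>y\<in>carrier K. \<phi> (x \<oplus> y) = \<phi> x + \<phi> y \<and> \<phi> (x \<otimes> y) = \<phi> x * \<phi> y)"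
proof -
  interpret field K by fact
  have fin: "finite (carrier K)"
    using assms(2) by (intro card_ge_0_finite) (simp add: Coset.order_def)
  have two: "\<one> \<oplus> \<one> = \<zero>" by (rule order_power_of_2_imp_char_2[OF assms(2)])
  obtain b where b: "b \<in> carrier (Multiplicative_Group.mult_of K)" "carrier (Multiplicative_Group.mult_of K) = {b [^]\<^bsub>K\<^esub> i | i::nat. i \<in> UNIV}"
    using finite_field_mult_group_has_gen[OF fin] by (elim bexE) (rule that)
  then have bK: "b \<in> carrier K" by (simp add: Multiplicative_Group.carrier_mult_of)
  define ib where "ib = (\<lambda>c::bit. if c = 1 then \<one> else \<zero>)"
  \<comment> \<open>Horner evaluation at the generator \<open>b\<close>, with coefficients moved
    into \<open>K\<close> by \<open>ib\<close>.\<close>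
  define ev where "ev = (\<lambda>p. fold_coeffs (\<lambda>c r. ib c \<oplus> b \<otimes> r) p \<zero>)"
  have ib: "ib c \<in> carrier K" for c by (simp add: ib_def)
  have ib_add: "ib (c + d) = ib c \<oplus> ib d" for c d
    by (cases c; cases d) (simp_all add: ib_def two)
  have "c + c = 0" for c :: bit by (cases c) simp_all
  then have qq: "q + q = 0" for q :: "bit poly"
    by (intro poly_eqI) (simp only: Polynomial.coeff_add Polynomial.coeff_0)
  have ev_0: "ev 0 = \<zero>" by (simp add: ev_def)
  have ev_pCons: "ev (pCons c p) = ib c \<oplus> b \<otimes> ev p" for c p
    by (cases "c = 0 \<and> p = 0") (auto simp: ev_def ib_def bK)
  have ev: "ev p \<in> carrier K" for p
    by (induction p) (auto simp: ev_0 ev_pCons ib bK)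
  have ev_add: "ev (p + q) = ev p \<oplus> ev q" for p q
  proof (induction p q rule: poly_induct2)
    case (pCons c p d q)
    then show ?case by (simp add: ev_pCons ib_add ib ev bK r_distr a_ac del: add_bit_eq_xor)
  qed (simp add: ev_0)
  have ev_smult: "ev (smult c p) = ib c \<otimes> ev p" for c p
    by (cases c) (auto simp: ev_0 ib_def ev)
  have ev_mult: "ev (p * q) = ev p \<otimes> ev q" for p q
  proof (induction p)
    case (pCons c p)
    have "ev (pCons c p * q) = ib c \<otimes> ev q \<oplus> (\<zero> \<oplus> b \<otimes> (ev p \<otimes> ev q))"
      unfolding mult_pCons_left ev_add ev_smult ev_pCons pCons.IH by (simp add: ib_def)
    also have "\<dots> = ev (pCons c p) \<otimes> ev q" by (simp add: ev_pCons ib ev bK l_distr m_assoc)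
    finally show ?case .
  qed (simp add: ev_0 ev)
  have ev_1: "ev 1 = \<one>" by (simp add: one_pCons ev_pCons ev_0 ib_def bK)
  have ev_monom: "ev (Polynomial.monom 1 i) = b [^] i" for i
  proof (induction i)
    case 0
    then show ?case by (simp add: ev_1 monom_0 flip: one_pCons)
  next
    case (Suc i)
    then show ?case by (simp add: monom_Suc ev_pCons ib_def bK m_comm)
  qed
  have surj: "\<exists>p. ev p = x" if "x \<in> carrier K" for x
  proof (cases "x = \<zero>")
    case False
    then have "x \<in> carrier (Multiplicative_Group.mult_of K)" using that by (simp add: Multiplicative_Group.carrier_mult_of)
    then obtain i :: nat where "x = b [^] i" using b(2) by auto
    then show ?thesis using ev_monom by blast
  qed (use ev_0 in blast)
  \<comment> \<open>Pigeonhole: two powers of the variable have the same value in the finite field,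
    and their sum, which is their difference, lies in the kernel.\<close>
  have "\<exists>p. p \<noteq> 0 \<and> ev p = \<zero>"
  proof -
    have "\<not> inj_on ev (Polynomial.monom 1 ` UNIV)"
    proof
      assume "inj_on ev (Polynomial.monom 1 ` (UNIV :: nat set))"
      then have "inj (\<lambda>i::nat. ev (Polynomial.monom 1 i))"
        by (intro comp_inj_on[of "Polynomial.monom 1" UNIV ev, unfolded comp_def] injI)
           (metis Polynomial.degree_monom_eq one_neq_zero)
      moreover have "finite (range (\<lambda>i::nat. ev (Polynomial.monom 1 i)))"
        by (rule finite_subset[OF _ fin]) (use ev in auto)
      ultimately show False using finite_imageD infinite_UNIV_nat by blast
    qed
    then obtain p q where pq: "ev p = ev q" "p \<noteq> q" by (auto simp: inj_on_def)
    then have "p + q \<noteq> 0" using pq(2) qq[of q] by (metis Groups.add_right_cancel)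
    moreover have "ev (p + q) = \<zero>"
      by (metis qq ev_0 ev_add pq(1))
    ultimately show ?thesis by blast
  qed
  then obtain m where m: "m \<noteq> 0" "ev m = \<zero>"
    and min: "\<And>p. p \<noteq> 0 \<Longrightarrow> ev p = \<zero> \<Longrightarrow> Polynomial.degree m \<le> Polynomial.degree p"
    using ex_has_least_nat[of "\<lambda>p. p \<noteq> 0 \<and> ev p = \<zero>" _ Polynomial.degree] by blast
  have "Polynomial.degree m > 0"
  proof (rule ccontr)
    assume "\<not> Polynomial.degree m > 0"
    then obtain c where "m = [:c:]" by (metis degree_eq_zeroE gr0I)
    with m(1) have "m = 1" by (cases c) (auto simp: one_pCons)
    with m(2) ev_1 show False by simp
  qed
  have ker: "m dvd p" if "ev p = \<zero>" for p
  proof -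
    have "ev p = ev (p div m * m) \<oplus> ev (p mod m)" by (metis div_mult_mod_eq ev_add)
    then have "ev (p mod m) = \<zero>" using that by (simp add: ev_mult m(2) ev)
    then have "p mod m = 0" using min[of "p mod m"] degree_mod_less[OF m(1), of p] by fastforce
    then show ?thesis by blast
  qed
  define ac where "ac = (map_poly to_ac :: bit poly \<Rightarrow> bit alg_closure poly)"
  have "degree (ac m) > 0" using \<open>Polynomial.degree m > 0\<close> by (simp add: ac_def degree_map_poly)
  then obtain z where z: "poly (ac m) z = 0" using alg_closed_imp_poly_has_root by blast
  define pv where "pv = (\<lambda>p. poly (ac p) z)"
  have pv_add: "pv (p + q) = pv p + pv q" for p q
  proof -
    have "ac (p + q) = ac p + ac q" by (rule poly_eqI) (simp add: ac_def coeff_map_poly del: add_bit_eq_xor)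
    then show ?thesis by (simp add: pv_def)
  qed
  have pv_mult: "pv (p * q) = pv p * pv q" for p q
  proof -
    have "ac (p * q) = ac p * ac q"
      by (rule poly_eqI) (simp add: ac_def coeff_map_poly coeff_mult to_ac_sum del: mult_bit_eq_and)
    then show ?thesis by (simp add: pv_def)
  qed
  \<comment> \<open>Makes the \<open>SOME\<close> in the definition of \<open>\<phi>\<close>
    harmless: preimages of the same element differ by a multiple of \<open>m\<close>, which vanishes
    at \<open>z\<close>.\<close>
  have pv_eq: "pv p = pv q" if "ev p = ev q" for p q
  proof -
    have "ev (p + q) = ev (q + q)" by (simp only: ev_add that)
    then have "m dvd p + q" by (intro ker) (simp add: qq ev_0)
    then obtain r where "p + q = m * r" by auto
    then have "p = q + m * r" by (metis Groups.add.assoc Groups.add.commute Groups.add.right_neutral qq)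
    then show ?thesis using z by (simp add: pv_add pv_mult) (simp add: pv_def)
  qed
  define \<phi> where "\<phi> = (\<lambda>x. pv (SOME p. ev p = x))"
  have \<phi>: "\<phi> (ev p) = pv p" for p
    unfolding \<phi>_def by (rule pv_eq) (rule someI[of _ p], simp)
  have add: "\<phi> (x \<oplus> y) = \<phi> x + \<phi> y" and mult: "\<phi> (x \<otimes> y) = \<phi> x * \<phi> y"
    if xy: "x \<in> carrier K" "y \<in> carrier K" for x y
  proof -
    obtain p q where "x = ev p" "y = ev q" using surj xy by metis
    then show "\<phi> (x \<oplus> y) = \<phi> x + \<phi> y" "\<phi> (x \<otimes> y) = \<phi> x * \<phi> y"
      by (simp_all add: \<phi> pv_add pv_mult flip: ev_add ev_mult)
  qed
  have one: "\<phi> \<one> = 1" using \<phi>[of 1] by (simp add: ev_1 pv_def ac_def)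
  have "inj_on \<phi> (carrier K)"
  proof (rule inj_onI, rule ccontr)
    fix x y assume xy: "x \<in> carrier K" "y \<in> carrier K" "\<phi> x = \<phi> y" "x \<noteq> y"
    have nz: "x \<ominus> y \<in> carrier K - {\<zero>}" using xy by (simp add: r_right_minus_eq)
    have "\<phi> x = \<phi> (x \<ominus> y) + \<phi> y"
      using add[of "x \<ominus> y" y] xy by (simp add: minus_eq a_assoc l_neg)
    then have "\<phi> (x \<ominus> y) = 0" using xy by simp
    moreover have "(x \<ominus> y) \<otimes> inv (x \<ominus> y) = \<one>" using nz by (simp add: field_Units)
    ultimately show False
      using one mult[of "x \<ominus> y" "inv (x \<ominus> y)"] nz by (simp add: field_Units)
  qed
  then show ?thesis using one add mult by blast
qed

lemma CHAR_bit_alg_closure: "CHAR(bit alg_closure) = 2"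
proof -
  have "(of_nat 2 :: bit) = 0" by simp
  then have "CHAR(bit) dvd 2" by (simp only: of_nat_eq_0_iff_char_dvd)
  then have "CHAR(bit) = 1 \<or> CHAR(bit) = 2" using prime_nat_iff two_is_prime_nat by blast
  then show ?thesis using CHAR_not_1[where 'a = bit] by auto
qed

text \<open>By Lagrange's theorem the image consists of roots of \<open>X ^ q - X\<close>. It has
  \<open>q\<close> elements and there are at most \<open>q\<close> roots, so the two sets
  agree.\<close>

lemma finite_field_embedding_image:
  fixes K :: "('a, 'm) ring_scheme" (structure) and \<phi> :: "'a \<Rightarrow> 'b::field"
  assumes "field K" "order K = q" "q \<ge> 2" and inj: "inj_on \<phi> (carrier K)"
    and phi_one: "\<phi> \<one> = 1" and phi_zero: "\<phi> \<zero> = 0"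
    and pow: "\<And>x k. x \<in> carrier K \<Longrightarrow> \<phi> (x [^] (k::nat)) = \<phi> x ^ k"
  shows "\<phi> ` carrier K = {z. z ^ q = z}" "card (\<phi> ` carrier K) = q"
proof -
  interpret field K by fact
  show card: "card (\<phi> ` carrier K) = q"
    using assms(2) by (simp add: card_image[OF inj] Coset.order_def)
  interpret M: group "Multiplicative_Group.mult_of K" by (rule field_mult_group)
  have sub: "\<phi> ` carrier K \<subseteq> {z. z ^ q = z}"
  proof clarify
    fix x assume x: "x \<in> carrier K"
    show "\<phi> x ^ q = \<phi> x"
    proof (cases "x = \<zero>")
      case True
      then show ?thesis using phi_zero assms(3) by simp
    next
      case False
      have "Coset.order (Multiplicative_Group.mult_of K) = q - 1"
        using assms(2,3) by (simp add: Coset.order_def)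
      then have "x [^] (q - 1) = \<one>"
        using M.pow_order_eq_1[of x] x False by (simp add: Multiplicative_Group.nat_pow_mult_of)
      then have "\<phi> x ^ (q - 1) = 1" using pow[OF x, of "q - 1"] phi_one by simp
      moreover have "\<phi> x ^ q = \<phi> x * \<phi> x ^ (q - 1)"
        using assms(3) by (cases q) auto
      ultimately show ?thesis by simp
    qed
  qed
  define p where "p = Polynomial.monom 1 q - [:0, 1 :: 'b:]"
  have "Polynomial.coeff p q = 1" using assms(3) by (auto simp: p_def coeff_pCons split: nat.split)
  then have p: "p \<noteq> 0" by auto
  have roots: "{z. z ^ q = z} = {z. poly p z = 0}" by (simp add: p_def poly_monom)
  have "Polynomial.degree p \<le> q"
    unfolding p_def using assms(3) by (intro degree_diff_le) (auto simp: Polynomial.degree_monom_le)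
  then have "card {z::'b. z ^ q = z} \<le> q"
    using card_poly_roots_le[OF p, of "{z. z ^ q = z}"] roots by simp
  moreover have "finite {z::'b. z ^ q = z}" unfolding roots by (rule poly_roots_finite[OF p])
  ultimately show "\<phi> ` carrier K = {z. z ^ q = z}" using sub card by (intro card_seteq) auto
qed

section \<open>Transfer of planarity to the algebraic closure\<close>

theorem theorem1p1:
  fixes t :: nat
  assumes "odd t"
    and "infinite {n :: nat. n > 0 \<and>
           (\<exists>K :: 'a ring. field K \<and> order K = 2 ^ n \<and>
             (\<exists>c \<in> carrier K - {\<zero>\<^bsub>K\<^esub>}. planar K (\<lambda>x. c \<otimes>\<^bsub>K\<^esub> x [^]\<^bsub>K\<^esub> t)))}"
  shows "t = 1"
proof (rule ccontr)
  assume "t \<noteq> 1"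
  then have t: "t \<ge> 3" using assms(1) by presburger
  obtain m where m: "2 ^ m \<ge> (t - 2) * (3 * t + 1) + 1"
    "\<And>d. odd d \<Longrightarrow> d \<le> t - 2 \<Longrightarrow> d dvd 2 ^ m - (1::nat)"
    using exists_power_of_two_congruent_1 by blast
  \<comment> \<open>\<open>m\<close> depends on \<open>t\<close> alone, so infinitely many
    \<open>n\<close> include one beyond the required bound.\<close>
  obtain n and K :: "'a ring" and c
    where n: "n \<ge> m + (t - 2) * (t - 2) * 2 ^ m * (3 * t + 1) + 1" "n > 0"
    and K: "field K" "order K = 2 ^ n"
    and c: "c \<in> carrier K - {\<zero>\<^bsub>K\<^esub>}"
    and planar: "planar K (\<lambda>x. c \<otimes>\<^bsub>K\<^esub> x [^]\<^bsub>K\<^esub> t)"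
    using assms(2) unfolding infinite_nat_iff_unbounded_le by blast
  interpret field K by (rule K(1))
  obtain \<phi> :: "'a \<Rightarrow> bit alg_closure" where inj: "inj_on \<phi> (carrier K)" and one: "\<phi> \<one>\<^bsub>K\<^esub> = 1"
    and add: "\<And>x y. x \<in> carrier K \<Longrightarrow> y \<in> carrier K \<Longrightarrow> \<phi> (x \<oplus>\<^bsub>K\<^esub> y) = \<phi> x + \<phi> y"
    and mult: "\<And>x y. x \<in> carrier K \<Longrightarrow> y \<in> carrier K \<Longrightarrow> \<phi> (x \<otimes>\<^bsub>K\<^esub> y) = \<phi> x * \<phi> y"
    using finite_field_char2_embedding[OF K n(2)] by blast
  have zero: "\<phi> \<zero>\<^bsub>K\<^esub> = 0"
    using add[of "\<zero>\<^bsub>K\<^esub>" "\<zero>\<^bsub>K\<^esub>"] by (metis zero_closed l_zero add_cancel_right_right)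
  have pow: "\<phi> (x [^]\<^bsub>K\<^esub> k) = \<phi> x ^ k" if "x \<in> carrier K" for x and k :: nat
    using that by (induction k) (simp_all add: one mult)
  have nonzero: "\<phi> x = 0 \<longleftrightarrow> x = \<zero>\<^bsub>K\<^esub>" if "x \<in> carrier K" for x
    using inj_on_eq_iff[OF inj that zero_closed] zero by simp
  define S where "S = \<phi> ` carrier K"
  have "(2::nat) ^ n \<ge> 2" using n(2) by (cases n) auto
  then have S: "S = {z. z ^ 2 ^ n = z}" "card S = 2 ^ n"
    unfolding S_def using finite_field_embedding_image[OF K _ inj one zero pow] by auto
  have self: "z + z = 0" for z :: "bit alg_closure"
    by (rule char2_add_self[OF CHAR_bit_alg_closure refl refl])
  show False
  proof (rule monomial_not_planar_over_large_field[OF CHAR_bit_alg_closure refl S(1) assms(1) t S(2) _ _ _ m n(1)])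
    show "\<phi> c \<in> S" "\<phi> c \<noteq> 0" using c nonzero by (auto simp: S_def)
    fix u y assume "u \<in> S" "u \<noteq> 0" "y \<in> S" "y \<noteq> 0"
    then obtain a b where a: "a \<in> carrier K" "a \<noteq> \<zero>\<^bsub>K\<^esub>" "u = \<phi> a"
      and b: "b \<in> carrier K" "b \<noteq> \<zero>\<^bsub>K\<^esub>" "y = \<phi> b"
      using zero by (auto simp: S_def)
    define F where "F = (\<lambda>x. c \<otimes>\<^bsub>K\<^esub> (x \<oplus>\<^bsub>K\<^esub> a) [^]\<^bsub>K\<^esub> t \<oplus>\<^bsub>K\<^esub> c \<otimes>\<^bsub>K\<^esub> x [^]\<^bsub>K\<^esub> t \<oplus>\<^bsub>K\<^esub> a \<otimes>\<^bsub>K\<^esub> x)"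
    have "inj_on F (carrier K)"
      using planar a unfolding planar_def F_def by (blast dest: bij_betw_imp_inj_on)
    moreover have "a \<otimes>\<^bsub>K\<^esub> b \<noteq> \<zero>\<^bsub>K\<^esub>" using a b integral by blast
    ultimately have "F (a \<otimes>\<^bsub>K\<^esub> b) \<noteq> F \<zero>\<^bsub>K\<^esub>" using a b by (auto dest: inj_onD)
    moreover have F: "F x \<in> carrier K"
      "\<phi> (F x) = \<phi> c * (\<phi> x + u) ^ t + \<phi> c * \<phi> x ^ t + u * \<phi> x" if "x \<in> carrier K" for x
      using that a c by (auto simp: F_def add mult pow)
    ultimately have neq: "\<phi> (F (a \<otimes>\<^bsub>K\<^esub> b)) \<noteq> \<phi> (F \<zero>\<^bsub>K\<^esub>)"
      using a b inj_on_eq_iff[OF inj F(1) F(1)] by simp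
    show "\<phi> c * u ^ t * ((y + 1) ^ t + y ^ t + 1) \<noteq> u ^ 2 * y"
    proof
      assume eq: "\<phi> c * u ^ t * ((y + 1) ^ t + y ^ t + 1) = u ^ 2 * y"
      \<comment> \<open>The part common to both summands of the value at
        \<open>a \<otimes> b\<close>; it occurs twice and cancels in characteristic two.\<close>
      define w where "w = \<phi> c * u ^ t * ((y + 1) ^ t + y ^ t)"
      have uy: "u * y + u = u * (y + 1)" by (simp add: distrib_left)
      have "\<phi> (F (a \<otimes>\<^bsub>K\<^esub> b)) = \<phi> c * (u * y + u) ^ t + \<phi> c * (u * y) ^ t + u * (u * y)"
        using a b by (simp add: F mult)
      also have "\<dots> = w + u ^ 2 * y"
        unfolding uy power_mult_distrib w_def by (simp add: distrib_left mult.assoc power2_eq_square)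
      also have "u ^ 2 * y = w + \<phi> c * u ^ t"
        unfolding eq[symmetric] w_def by (simp add: distrib_left)
      also have "w + (w + \<phi> c * u ^ t) = \<phi> c * u ^ t" by (metis add.assoc self add_0_left)
      also have "\<dots> = \<phi> (F \<zero>\<^bsub>K\<^esub>)" using t by (simp add: F zero)
      finally show False using neq by simp
    qed
  qed
qed

end
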